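(* If $R$ is a quasiorder on a non-empty set $U$, then both $\mathcal{RS}$ and its dual $\mathcal{RS}^{\mathrm{op}}$ are pseudocomplemented lattices.
   Context: A quasiorder is a reflexive and transitive binary relation. For $x\in U$, $R(x)=\{y\in U\mid x\,R\,y\}$. For $X\subseteq U$, $X^{\blacktriangledown}=\{x\in U\mid R(x)\subseteq X\}$ and $X^{\blacktriangle}=\{x\in U\mid R(x)\cap X\neq\emptyset\}$. The rough set of $X$ is $\mathcal{A}(X)=(X^{\blacktriangledown},X^{\blacktriangle})$, $RS=\{\mathcal{A}(X)\mid X\subseteq U\}$, and $\mathcal{RS}=(RS,\leq)$ with $\leq$ the coordinatewise inclusion order on pairs of sets. $\mathcal{RS}^{\mathrm{op}}$ is $RS$ with the reversed order. In a lattice with least element $0$, $x^*$ is a pseudocomplement of $x$ if $x\wedge x^*=0$ and, for all $a$, $x\wedge a=0$ implies $a\leq x^*$. A lattice with least element is pseudocomplemented if every element has a pseudocomplement. *)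

theory Defs
  imports "HOL-Algebra.Lattice"
begin

definition rel_image :: "'a set \<Rightarrow> 'a rel \<Rightarrow> 'a \<Rightarrow> 'a set" where
  "rel_image U R x = {y \<in> U. (x, y) \<in> R}"

definition lower_approx :: "'a set \<Rightarrow> 'a rel \<Rightarrow> 'a set \<Rightarrow> 'a set" where
  "lower_approx U R X = {x \<in> U. rel_image U R x \<subseteq> X}"

definition upper_approx :: "'a set \<Rightarrow> 'a rel \<Rightarrow> 'a set \<Rightarrow> 'a set" where
  "upper_approx U R X = {x \<in> U. rel_image U R x \<inter> X \<noteq> {}}"

definition rough_set :: "'a set \<Rightarrow> 'a rel \<Rightarrow> 'a set \<Rightarrow> 'a set \<times> 'a set" where
  "rough_set U R X = (lower_approx U R X, upper_approx U R X)"

definition rough_sets :: "'a set \<Rightarrow> 'a rel \<Rightarrow> ('a set \<times> 'a set) set" where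
  "rough_sets U R = rough_set U R ` Pow U"

definition rough_order :: "'a set \<Rightarrow> 'a rel \<Rightarrow> ('a set \<times> 'a set) gorder" where
  "rough_order U R =
     \<lparr> carrier = rough_sets U R,
       eq = (=),
       le = (\<lambda>p q. fst p \<subseteq> fst q \<and> snd p \<subseteq> snd q) \<rparr>"

definition is_pseudocomplement :: "('a, 'b) gorder_scheme \<Rightarrow> 'a \<Rightarrow> 'a \<Rightarrow> bool" where
  "is_pseudocomplement L x y \<longleftrightarrow>
     y \<in> carrier L \<and> x \<sqinter>\<^bsub>L\<^esub> y = \<bottom>\<^bsub>L\<^esub> \<and>
     (\<forall>a \<in> carrier L. x \<sqinter>\<^bsub>L\<^esub> a = \<bottom>\<^bsub>L\<^esub> \<longrightarrow> a \<sqsubseteq>\<^bsub>L\<^esub> y)"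

(* Only a least element is required; the locale weak_partial_order_bottom adds
   precisely its existence to the partial order underlying the lattice. *)
locale pseudocomplemented_lattice = lattice L + weak_partial_order_bottom L
  for L (structure) +
  assumes pseudocomplement_exists:
    "x \<in> carrier L \<Longrightarrow> \<exists>y. is_pseudocomplement L x y"

end

theory Submission
  imports Defs
begin

text \<open>
  The proof describes rough sets without mentioning the set \<open>X\<close> that they approximate. For a
  quasiorder, a pair \<open>(A, B)\<close> is a rough set iff \<open>A\<close> is closed under \<open>R\<close>-successors, \<open>B\<close> under
  \<open>R\<close>-predecessors, \<open>A \<subseteq> B\<close>, and every point of \<open>B\<close> that sees only itself lies in \<open>A\<close>
  (lemma \<open>rough_sets_iff\<close>). The last condition is forced because \<open>R(x) = {x}\<close> makes
  \<open>R(x) \<inter> X \<noteq> {}\<close> and \<open>R(x) \<subseteq> X\<close> equivalent.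

  All four conditions survive arbitrary coordinatewise unions and intersections. Hence meets and
  joins of rough sets are computed coordinatewise. Since intersection distributes over arbitrary
  unions, the union of all rough sets disjoint from \<open>x\<close> is still disjoint from \<open>x\<close>, so it is the
  pseudocomplement of \<open>x\<close>; dually, the intersection of all rough sets that together with \<open>x\<close>
  cover \<open>(U, U)\<close> is the pseudocomplement in the opposite order.

  The substance is the sufficiency of the conditions: a set \<open>X\<close> with the prescribed approximations
  has to be built. Wherever an entire up-set \<open>R(x)\<close> lies in \<open>B - A\<close>, the set \<open>X\<close> has to meet it and
  to miss part of it. So the points with \<open>R(x) \<subseteq> B - A\<close> must be split into two parts,
  each cofinal in the whole (lemma \<open>cofinal_splitting\<close>). Such a splitting exists by Zorn's lemma
  as soon as every point sees a point other than itself, and this is what the condition on points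
  that see only themselves guarantees outside \<open>A\<close>.
\<close>

section \<open>Splitting a quasiorder into two cofinal parts\<close>

text \<open>
  A partial two-colouring of \<open>P\<close> in which every coloured point lies below a point of the opposite
  colour. Colourings are kept as sets of coloured points, so that extension of colourings is
  inclusion and Zorn's lemma for the subset relation applies.
\<close>

definition alternating_colouring :: "'a set \<Rightarrow> 'a rel \<Rightarrow> ('a \<times> bool) set \<Rightarrow> bool" where
  "alternating_colouring P R G \<longleftrightarrow>
     G \<subseteq> P \<times> UNIV \<and>
     (\<forall>x b c. (x, b) \<in> G \<longrightarrow> (x, c) \<in> G \<longrightarrow> b = c) \<and>
     (\<forall>x b. (x, b) \<in> G \<longrightarrow> (\<exists>y. (x, y) \<in> R \<and> (y, \<not> b) \<in> G))"

lemma alternating_colouring_Union_chain: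
  assumes "subset.chain {G. alternating_colouring P R G} C"
  shows "alternating_colouring P R (\<Union>C)"
proof -
  have ac: "alternating_colouring P R G" if "G \<in> C" for G
    using assms that by (auto simp: subset.chain_def)
  have tot: "G \<subseteq> H \<or> H \<subseteq> G" if "G \<in> C" "H \<in> C" for G H
    using assms that unfolding subset.chain_def by auto
  have "b = c" if bc: "(x, b) \<in> \<Union>C" "(x, c) \<in> \<Union>C" for x b c
  proof -
    obtain G H where GH: "G \<in> C" "(x, b) \<in> G" "H \<in> C" "(x, c) \<in> H" using bc by blast
    then consider "(x, b) \<in> H" | "(x, c) \<in> G" using tot by blast
    then show ?thesis using ac GH unfolding alternating_colouring_def by metis
  qed
  moreover have "\<exists>y. (x, y) \<in> R \<and> (y, \<not> b) \<in> \<Union>C" if "(x, b) \<in> \<Union>C" for x b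
    using that ac unfolding alternating_colouring_def by blast
  moreover have "\<Union>C \<subseteq> P \<times> UNIV"
    using ac unfolding alternating_colouring_def by blast
  ultimately show ?thesis unfolding alternating_colouring_def by blast
qed

lemma alternating_colouring_Un:
  assumes "alternating_colouring P R G" "alternating_colouring P R H" "fst ` G \<inter> fst ` H = {}"
  shows "alternating_colouring P R (G \<union> H)"
proof -
  have "b = c" if "(x, b) \<in> G \<union> H" "(x, c) \<in> G \<union> H" for x b c
  proof -
    have "x \<notin> fst ` G \<or> x \<notin> fst ` H" using assms(3) by blast
    then have "(x, b) \<in> G \<and> (x, c) \<in> G \<or> (x, b) \<in> H \<and> (x, c) \<in> H"
      using that by (metis Un_iff fst_conv image_eqI)
    then show ?thesis using assms(1,2) unfolding alternating_colouring_def by blast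
  qed
  then show ?thesis
    using assms(1,2) unfolding alternating_colouring_def by blast
qed

text \<open>
  Two distinct points that see each other can be coloured differently. In the absence of such
  points above \<open>x\<close>, repeatedly moving to a different successor never returns to an earlier point,
  so the resulting sequence can be coloured by the parity of its index.
\<close>

lemma alternating_colouring_above:
  assumes refl: "\<And>x. x \<in> P \<Longrightarrow> (x, x) \<in> R" and "trans R"
    and succ: "\<And>x. x \<in> P \<Longrightarrow> \<exists>y\<in>P. (x, y) \<in> R \<and> y \<noteq> x"
    and "x \<in> P"
  obtains G where "alternating_colouring P R G" "G \<noteq> {}" "fst ` G \<subseteq> R `` {x}"
proof -
  obtain f where f: "\<And>y. y \<in> P \<Longrightarrow> f y \<in> P \<and> (y, f y) \<in> R \<and> f y \<noteq> y"
    using succ by metis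
  define s where "s n = (f ^^ n) x" for n
  have s0: "s 0 = x" and sSuc: "s (Suc n) = f (s n)" for n by (simp_all add: s_def)
  have sP: "s n \<in> P" for n by (induction n) (use f s0 sSuc \<open>x \<in> P\<close> in auto)
  have mono: "(s i, s j) \<in> R" if "i \<le> j" for i j
    using that
  proof (induction rule: dec_induct)
    case base
    then show ?case using refl sP by blast
  next
    case (step n)
    then show ?case using f[OF sP[of n]] sSuc \<open>trans R\<close> by (metis transD)
  qed
  have below: "(x, s n) \<in> R" for n using mono[of 0 n] s0 by simp
  show ?thesis
  proof (cases "inj s")
    case True
    let ?G = "range (\<lambda>n. (s n, even n))"
    have "alternating_colouring P R ?G"
      unfolding alternating_colouring_def
    proof (intro conjI allI impI)
      show "?G \<subseteq> P \<times> UNIV" using sP by auto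
      show "b = c" if "(y, b) \<in> ?G" "(y, c) \<in> ?G" for y b c
        using that True by (auto dest: injD)
      show "\<exists>z. (y, z) \<in> R \<and> (z, \<not> b) \<in> ?G" if "(y, b) \<in> ?G" for y b
      proof -
        obtain n where "y = s n" "b = even n" using \<open>(y, b) \<in> ?G\<close> by auto
        moreover have "(s (Suc n), even (Suc n)) \<in> ?G" by blast
        ultimately show ?thesis using mono[of n "Suc n"] by auto
      qed
    qed
    then show ?thesis by (rule that) (use below in auto)
  next
    case False
    then obtain i j where ij: "i < j" "s i = s j" by (metis injI linorder_neqE_nat)
    then have "(s (Suc i), s i) \<in> R" using mono[of "Suc i" j] by simp
    moreover have "(s i, s (Suc i)) \<in> R" by (simp add: mono)
    moreover have "s (Suc i) \<noteq> s i" using f sP sSuc by metis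
    ultimately have "alternating_colouring P R {(s i, True), (s (Suc i), False)}"
      using sP unfolding alternating_colouring_def by auto
    then show ?thesis by (rule that) (simp_all add: below)
  qed
qed

text \<open>
  In a maximal alternating colouring every point lies below a coloured one, since otherwise
  the points above it could be coloured in addition; alternation then puts it below both colours.
\<close>

lemma cofinal_splitting:
  assumes refl: "\<And>x. x \<in> P \<Longrightarrow> (x, x) \<in> R" and "trans R"
    and succ: "\<And>x. x \<in> P \<Longrightarrow> \<exists>y\<in>P. (x, y) \<in> R \<and> y \<noteq> x"
  obtains D where "D \<subseteq> P"
    and "\<And>x. x \<in> P \<Longrightarrow> \<exists>y\<in>D. (x, y) \<in> R"
    and "\<And>x. x \<in> P \<Longrightarrow> \<exists>y\<in>P - D. (x, y) \<in> R"
proof -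
  let ?\<C> = "{G. alternating_colouring P R G}"
  have "\<exists>G\<in>?\<C>. \<forall>H\<in>?\<C>. G \<subseteq> H \<longrightarrow> H = G"
    by (rule subset_Zorn') (simp add: alternating_colouring_Union_chain)
  then obtain G where G: "alternating_colouring P R G"
    and max: "\<And>H. alternating_colouring P R H \<Longrightarrow> G \<subseteq> H \<Longrightarrow> H = G"
    by auto
  have both: "\<exists>y. (x, y) \<in> R \<and> (y, b) \<in> G" if "x \<in> P" for x b
  proof -
    have "\<exists>y c. (x, y) \<in> R \<and> (y, c) \<in> G"
    proof (rule ccontr)
      assume no: "\<nexists>y c. (x, y) \<in> R \<and> (y, c) \<in> G"
      obtain H where H: "alternating_colouring P R H" "H \<noteq> {}" "fst ` H \<subseteq> R `` {x}"
        using alternating_colouring_above[OF refl \<open>trans R\<close> succ \<open>x \<in> P\<close>] by blast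
      have "fst ` G \<inter> fst ` H = {}" using no H(3) by fastforce
      then have "alternating_colouring P R (G \<union> H)" and "G \<inter> H = {}"
        using alternating_colouring_Un[OF G H(1)] by blast+
      then show False using max[of "G \<union> H"] H(2) by blast
    qed
    then obtain y c where y: "(x, y) \<in> R" "(y, c) \<in> G" by blast
    then obtain z where z: "(y, z) \<in> R" "(z, \<not> c) \<in> G"
      using G unfolding alternating_colouring_def by blast
    have "(x, z) \<in> R" using \<open>trans R\<close> y z by (meson transD)
    then show ?thesis using y z by (cases "b = c") auto
  qed
  let ?D = "{y. (y, True) \<in> G}"
  have "?D \<subseteq> P" and "{y. (y, False) \<in> G} \<subseteq> P - ?D"
    using G unfolding alternating_colouring_def by auto
  then show ?thesis using that[of ?D] both by blast
qed

section \<open>Rough sets of a quasiorder\<close>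

lemma rough_sets_only_if:
  assumes "preorder_on U R" and "(A, B) \<in> rough_sets U R"
  shows "A \<subseteq> B" "B \<subseteq> U" "\<And>x. x \<in> A \<Longrightarrow> rel_image U R x \<subseteq> A"
    "\<And>x. x \<in> U \<Longrightarrow> rel_image U R x \<inter> B \<noteq> {} \<Longrightarrow> x \<in> B"
    "\<And>x. x \<in> B \<Longrightarrow> rel_image U R x = {x} \<Longrightarrow> x \<in> A"
proof -
  have refl: "\<And>x. x \<in> U \<Longrightarrow> (x, x) \<in> R" and tr: "\<And>x y z. (x, y) \<in> R \<Longrightarrow> (y, z) \<in> R \<Longrightarrow> (x, z) \<in> R"
    using assms(1) unfolding preorder_on_def refl_on_def trans_def by blast+
  obtain X where "X \<subseteq> U" "A = lower_approx U R X" "B = upper_approx U R X"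
    using assms(2) unfolding rough_sets_def rough_set_def by auto
  then have A: "A = {x \<in> U. rel_image U R x \<subseteq> X}" and B: "B = {x \<in> U. rel_image U R x \<inter> X \<noteq> {}}"
    by (simp_all add: lower_approx_def upper_approx_def)
  show "A \<subseteq> B" using refl unfolding A B rel_image_def by blast
  show "B \<subseteq> U" unfolding B by blast
  show "rel_image U R x \<subseteq> A" if "x \<in> A" for x
    using that unfolding A rel_image_def by (auto intro: tr)
  show "x \<in> B" if "x \<in> U" "rel_image U R x \<inter> B \<noteq> {}" for x
    using that unfolding B rel_image_def by (auto intro: tr)
  show "x \<in> A" if "x \<in> B" "rel_image U R x = {x}" for x
    using that unfolding A B by auto
qed

text \<open>
  The approximated set \<open>X\<close> consists of \<open>A\<close>, one half of a cofinal splitting of the points with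
  \<open>R(x) \<subseteq> B - A\<close>, and all points of \<open>B\<close> that see something outside \<open>B\<close>. The last part puts these
  points into the upper approximation by reflexivity; since \<open>X \<subseteq> B\<close>, they stay outside the lower
  one. A point with \<open>R(x) \<subseteq> B\<close> sees \<open>A\<close>, or else it is one of the points that were split.
\<close>

lemma rough_sets_if:
  assumes "preorder_on U R"
    and "A \<subseteq> B" "B \<subseteq> U"
    and up: "\<And>x. x \<in> A \<Longrightarrow> rel_image U R x \<subseteq> A"
    and down: "\<And>x. x \<in> U \<Longrightarrow> rel_image U R x \<inter> B \<noteq> {} \<Longrightarrow> x \<in> B"
    and single: "\<And>x. x \<in> B \<Longrightarrow> rel_image U R x = {x} \<Longrightarrow> x \<in> A"
  shows "(A, B) \<in> rough_sets U R"
proof -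
  have refl: "\<And>x. x \<in> U \<Longrightarrow> (x, x) \<in> R" and tr: "trans R"
    using assms(1) unfolding preorder_on_def refl_on_def by blast+
  define P where "P = {x \<in> U. rel_image U R x \<subseteq> B - A}"
  have PU: "P \<subseteq> U" and PBA: "P \<subseteq> B - A" using refl unfolding P_def rel_image_def by auto
  have P_up: "y \<in> P" if "x \<in> P" "(x, y) \<in> R" "y \<in> U" for x y
    using that tr unfolding P_def rel_image_def trans_def by blast
  have succ: "\<exists>y\<in>P. (x, y) \<in> R \<and> y \<noteq> x" if "x \<in> P" for x
  proof -
    have "rel_image U R x \<noteq> {x}" using single PBA \<open>x \<in> P\<close> by blast
    moreover have "x \<in> rel_image U R x" using refl PU \<open>x \<in> P\<close> unfolding rel_image_def by blast
    ultimately obtain y where "y \<in> rel_image U R x" "y \<noteq> x" by blast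
    then show ?thesis using P_up \<open>x \<in> P\<close> unfolding rel_image_def by blast
  qed
  obtain D where D: "D \<subseteq> P" "\<And>x. x \<in> P \<Longrightarrow> \<exists>y\<in>D. (x, y) \<in> R"
    "\<And>x. x \<in> P \<Longrightarrow> \<exists>y\<in>P - D. (x, y) \<in> R"
    using cofinal_splitting[of P R] refl PU tr succ by blast
  define X where "X = A \<union> D \<union> {x \<in> B. \<not> rel_image U R x \<subseteq> B}"
  have XB: "X \<subseteq> B" using \<open>A \<subseteq> B\<close> D(1) PBA unfolding X_def by blast
  have lower: "lower_approx U R X = A"
  proof (intro equalityI subsetI)
    fix x assume "x \<in> lower_approx U R X"
    then have x: "x \<in> U" "rel_image U R x \<subseteq> X" unfolding lower_approx_def by auto
    then have "x \<in> X" "rel_image U R x \<subseteq> B" using refl XB unfolding rel_image_def by auto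
    then consider "x \<in> A" | "x \<in> D" unfolding X_def by blast
    then show "x \<in> A"
    proof cases
      case 2
      then obtain y where y: "y \<in> P - D" "(x, y) \<in> R" using D by blast
      then have "y \<in> X" using x PU unfolding rel_image_def by blast
      \<comment> \<open>impossible: \<open>y \<in> P\<close> is outside \<open>A\<close> and sees only points of \<open>B\<close>, and it was chosen outside \<open>D\<close>\<close>
      then show ?thesis using y PBA unfolding X_def P_def by blast
    qed
  next
    fix x assume "x \<in> A"
    then show "x \<in> lower_approx U R X"
      using up assms(2,3) unfolding lower_approx_def X_def by blast
  qed
  have upper: "upper_approx U R X = B"
  proof (intro equalityI subsetI)
    fix x assume "x \<in> upper_approx U R X"
    then show "x \<in> B" using down XB unfolding upper_approx_def by blast
  next
    fix x assume x: "x \<in> B"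
    then have "x \<in> U" using assms(3) by blast
    have "rel_image U R x \<inter> X \<noteq> {}"
    proof (cases "rel_image U R x \<subseteq> B")
      case False
      then show ?thesis using x \<open>x \<in> U\<close> refl unfolding X_def rel_image_def by blast
    next
      case True
      show ?thesis
      proof (cases "rel_image U R x \<inter> A = {}")
        case False
        then show ?thesis unfolding X_def by blast
      next
        case disj: True
        then have "x \<in> P" using True \<open>x \<in> U\<close> unfolding P_def by blast
        then show ?thesis using D(1,2) PU unfolding X_def rel_image_def by blast
      qed
    qed
    then show "x \<in> upper_approx U R X" using \<open>x \<in> U\<close> unfolding upper_approx_def by blast
  qed
  have "rough_set U R X \<in> rough_sets U R"
    using XB assms(3) unfolding rough_sets_def by blast
  then show ?thesis unfolding rough_set_def lower upper .
qed

lemma rough_sets_iff: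
  assumes "preorder_on U R"
  shows "p \<in> rough_sets U R \<longleftrightarrow>
    fst p \<subseteq> snd p \<and> snd p \<subseteq> U \<and>
    (\<forall>x\<in>fst p. rel_image U R x \<subseteq> fst p) \<and>
    (\<forall>x\<in>U. rel_image U R x \<inter> snd p \<noteq> {} \<longrightarrow> x \<in> snd p) \<and>
    (\<forall>x\<in>snd p. rel_image U R x = {x} \<longrightarrow> x \<in> fst p)"
  (is "_ \<longleftrightarrow> ?C")
proof
  assume "p \<in> rough_sets U R"
  then have "(fst p, snd p) \<in> rough_sets U R" by simp
  note p = rough_sets_only_if[OF assms this]
  show ?C by (intro conjI ballI impI) (fact p(1), fact p(2), (erule p(3-5); assumption?)+)
next
  assume C: ?C
  have "(fst p, snd p) \<in> rough_sets U R"
    by (rule rough_sets_if[OF assms]) (use C in blast)+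
  then show "p \<in> rough_sets U R" by simp
qed

lemma rough_sets_Union:
  assumes "preorder_on U R" and "F \<subseteq> rough_sets U R"
  shows "(\<Union>p\<in>F. fst p, \<Union>p\<in>F. snd p) \<in> rough_sets U R"
proof (rule rough_sets_if[OF assms(1)])
  have F: "(fst p, snd p) \<in> rough_sets U R" if "p \<in> F" for p
    using assms(2) that by auto
  note F = rough_sets_only_if[OF assms(1) F]
  show "(\<Union>p\<in>F. fst p) \<subseteq> (\<Union>p\<in>F. snd p)" using F(1) by blast
  show "(\<Union>p\<in>F. snd p) \<subseteq> U" using F(2) by blast
  show "rel_image U R x \<subseteq> (\<Union>p\<in>F. fst p)" if "x \<in> (\<Union>p\<in>F. fst p)" for x
    using F(3) that by blast
  show "x \<in> (\<Union>p\<in>F. snd p)" if "x \<in> U" "rel_image U R x \<inter> (\<Union>p\<in>F. snd p) \<noteq> {}" for x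
    using F(4)[OF _ that(1)] that(2) by blast
  show "x \<in> (\<Union>p\<in>F. fst p)" if "x \<in> (\<Union>p\<in>F. snd p)" "rel_image U R x = {x}" for x
    using F(5)[OF _ _ that(2)] that(1) by blast
qed

lemma rough_sets_Inter:
  assumes "preorder_on U R" and "F \<subseteq> rough_sets U R" and "F \<noteq> {}"
  shows "(\<Inter>p\<in>F. fst p, \<Inter>p\<in>F. snd p) \<in> rough_sets U R"
proof (rule rough_sets_if[OF assms(1)])
  have F: "(fst p, snd p) \<in> rough_sets U R" if "p \<in> F" for p
    using assms(2) that by auto
  note F = rough_sets_only_if[OF assms(1) F]
  show "(\<Inter>p\<in>F. fst p) \<subseteq> (\<Inter>p\<in>F. snd p)" using F(1) by blast
  show "(\<Inter>p\<in>F. snd p) \<subseteq> U" using F(2) assms(3) by blast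
  show "rel_image U R x \<subseteq> (\<Inter>p\<in>F. fst p)" if "x \<in> (\<Inter>p\<in>F. fst p)" for x
    using F(3) that by blast
  show "x \<in> (\<Inter>p\<in>F. snd p)" if "x \<in> U" "rel_image U R x \<inter> (\<Inter>p\<in>F. snd p) \<noteq> {}" for x
    using F(4)[OF _ that(1)] that(2) by blast
  show "x \<in> (\<Inter>p\<in>F. fst p)" if "x \<in> (\<Inter>p\<in>F. snd p)" "rel_image U R x = {x}" for x
    using F(5)[OF _ _ that(2)] that(1) by blast
qed

lemma rough_sets_Un:
  assumes "preorder_on U R" and "p \<in> rough_sets U R" "q \<in> rough_sets U R"
  shows "(fst p \<union> fst q, snd p \<union> snd q) \<in> rough_sets U R"
  using rough_sets_Union[OF assms(1), of "{p, q}"] assms(2,3) by simp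

lemma rough_sets_Int:
  assumes "preorder_on U R" and "p \<in> rough_sets U R" "q \<in> rough_sets U R"
  shows "(fst p \<inter> fst q, snd p \<inter> snd q) \<in> rough_sets U R"
  using rough_sets_Inter[OF assms(1), of "{p, q}"] assms(2,3) by simp

section \<open>Pseudocomplements in both orders\<close>

text \<open>
  The operations \<open>\<sqinter>\<close> and \<open>\<bottom>\<close> of an ordered structure are chosen by description; this rule replaces
  them by concrete functions known to be greatest lower bound and least element.
\<close>

lemma pseudocomplemented_latticeI:
  assumes "partial_order L"
    and bot: "least L b (carrier L)"
    and meet: "\<And>x y. x \<in> carrier L \<Longrightarrow> y \<in> carrier L \<Longrightarrow> greatest L (m x y) (Lower L {x, y})"
    and join: "\<And>x y. x \<in> carrier L \<Longrightarrow> y \<in> carrier L \<Longrightarrow> \<exists>s. least L s (Upper L {x, y})"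
    and pc: "\<And>x. x \<in> carrier L \<Longrightarrow>
      \<exists>y\<in>carrier L. m x y = b \<and> (\<forall>a\<in>carrier L. m x a = b \<longrightarrow> a \<sqsubseteq>\<^bsub>L\<^esub> y)"
  shows "pseudocomplemented_lattice L"
proof -
  interpret partial_order L by fact
  interpret lattice L
    by unfold_locales (use meet join in blast)+
  interpret weak_partial_order_bottom L
    by unfold_locales (use bot in blast)
  have bot_eq: "\<bottom>\<^bsub>L\<^esub> = b"
    using least_unique[OF bottom_least bot] .
  have meet_eq: "x \<sqinter>\<^bsub>L\<^esub> y = m x y" if "x \<in> carrier L" "y \<in> carrier L" for x y
    by (rule meetI[OF _ that]) (rule greatest_unique[OF _ meet[OF that]])
  show ?thesis
  proof unfold_locales
    fix x assume x: "x \<in> carrier L"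
    then show "\<exists>y. is_pseudocomplement L x y"
      using pc[OF x] unfolding is_pseudocomplement_def bot_eq by (metis meet_eq)
  qed
qed

lemma partial_order_rough_order: "partial_order (rough_order U R)"
  by unfold_locales (auto simp: rough_order_def prod_eq_iff)

lemma partial_order_inv_rough_order: "partial_order (inv_gorder (rough_order U R))"
  by unfold_locales (auto simp: rough_order_def prod_eq_iff)

lemma pseudocomplemented_rough_order:
  assumes "preorder_on U R"
  shows "pseudocomplemented_lattice (rough_order U R)"
proof (rule pseudocomplemented_latticeI[where b = "({}, {})"
      and m = "\<lambda>p q. (fst p \<inter> fst q, snd p \<inter> snd q)"])
  let ?L = "rough_order U R"
  show "partial_order ?L" by (rule partial_order_rough_order)
  have "({}, {}) \<in> rough_sets U R" using rough_sets_Union[OF assms, of "{}"] by simp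
  then show "least ?L ({}, {}) (carrier ?L)" unfolding least_def rough_order_def by auto
  fix x assume "x \<in> carrier ?L"
  then have x: "x \<in> rough_sets U R" by (simp add: rough_order_def)
  show "greatest ?L (fst x \<inter> fst y, snd x \<inter> snd y) (Lower ?L {x, y})" if "y \<in> carrier ?L" for y
    using rough_sets_Int[OF assms x, of y] x that
    unfolding greatest_def Lower_def rough_order_def by (auto simp del: split_paired_All)
  show "\<exists>s. least ?L s (Upper ?L {x, y})" if "y \<in> carrier ?L" for y
    using rough_sets_Un[OF assms x, of y] x that
    by (intro exI[of _ "(fst x \<union> fst y, snd x \<union> snd y)"])
      (auto simp: least_def Upper_def rough_order_def simp del: split_paired_All)
  define F where
    "F = {a \<in> rough_sets U R. (fst x \<inter> fst a, snd x \<inter> snd a) = ({}, {})}"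
  let ?y = "(\<Union>p\<in>F. fst p, \<Union>p\<in>F. snd p)"
  have "?y \<in> rough_sets U R"
    by (rule rough_sets_Union[OF assms]) (simp add: F_def Collect_subset)
  then have "?y \<in> carrier ?L" by (simp add: rough_order_def)
  moreover have "fst x \<inter> fst p = {}" "snd x \<inter> snd p = {}" if "p \<in> F" for p
    using that by (simp_all add: F_def)
  then have "(fst x \<inter> fst ?y, snd x \<inter> snd ?y) = ({}, {})"
    unfolding fst_conv snd_conv prod.inject by blast
  moreover have "\<forall>a\<in>carrier ?L. (fst x \<inter> fst a, snd x \<inter> snd a) = ({}, {}) \<longrightarrow> a \<sqsubseteq>\<^bsub>?L\<^esub> ?y"
  proof (intro ballI impI)
    fix a assume "a \<in> carrier ?L" "(fst x \<inter> fst a, snd x \<inter> snd a) = ({}, {})"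
    then have "a \<in> F" by (simp add: rough_order_def F_def)
    then have "fst a \<subseteq> fst ?y \<and> snd a \<subseteq> snd ?y" unfolding fst_conv snd_conv by blast
    then show "a \<sqsubseteq>\<^bsub>?L\<^esub> ?y" by (simp add: rough_order_def)
  qed
  ultimately show "\<exists>y\<in>carrier ?L. (fst x \<inter> fst y, snd x \<inter> snd y) = ({}, {}) \<and>
      (\<forall>a\<in>carrier ?L. (fst x \<inter> fst a, snd x \<inter> snd a) = ({}, {}) \<longrightarrow> a \<sqsubseteq>\<^bsub>?L\<^esub> y)"
    by (intro bexI[of _ ?y] conjI)
qed

lemma pseudocomplemented_inv_rough_order:
  assumes "preorder_on U R"
  shows "pseudocomplemented_lattice (inv_gorder (rough_order U R))"
proof (rule pseudocomplemented_latticeI[where b = "(U, U)"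
      and m = "\<lambda>p q. (fst p \<union> fst q, snd p \<union> snd q)"])
  let ?L = "inv_gorder (rough_order U R)"
  show "partial_order ?L" by (rule partial_order_inv_rough_order)
  have top: "(U, U) \<in> rough_sets U R"
    unfolding rough_sets_iff[OF assms] rel_image_def by auto
  have le_top: "fst p \<subseteq> U \<and> snd p \<subseteq> U" if "p \<in> rough_sets U R" for p
    using that unfolding rough_sets_iff[OF assms] by blast
  show "least ?L (U, U) (carrier ?L)"
    using top le_top unfolding least_def rough_order_def by auto
  fix x assume "x \<in> carrier ?L"
  then have x: "x \<in> rough_sets U R" by (simp add: rough_order_def)
  show "greatest ?L (fst x \<union> fst y, snd x \<union> snd y) (Lower ?L {x, y})" if "y \<in> carrier ?L" for y
    using rough_sets_Un[OF assms x, of y] x that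
    unfolding greatest_def Lower_def rough_order_def by (auto simp del: split_paired_All)
  show "\<exists>s. least ?L s (Upper ?L {x, y})" if "y \<in> carrier ?L" for y
    using rough_sets_Int[OF assms x, of y] x that
    by (intro exI[of _ "(fst x \<inter> fst y, snd x \<inter> snd y)"])
      (auto simp: least_def Upper_def rough_order_def simp del: split_paired_All)
  define F where
    "F = {a \<in> rough_sets U R. (fst x \<union> fst a, snd x \<union> snd a) = (U, U)}"
  have "(U, U) \<in> F" using top le_top[OF x] by (simp add: F_def Un_absorb1)
  let ?y = "(\<Inter>p\<in>F. fst p, \<Inter>p\<in>F. snd p)"
  have y: "?y \<in> rough_sets U R"
  proof (rule rough_sets_Inter[OF assms])
    show "F \<subseteq> rough_sets U R" by (simp add: F_def Collect_subset)
    show "F \<noteq> {}" using \<open>(U, U) \<in> F\<close> by blast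
  qed
  have "fst x \<union> fst p = U" "snd x \<union> snd p = U" if "p \<in> F" for p
    using that by (simp_all add: F_def)
  then have "(fst x \<union> fst ?y, snd x \<union> snd ?y) = (U, U)"
    using \<open>(U, U) \<in> F\<close> unfolding fst_conv snd_conv prod.inject by blast
  moreover have "\<forall>a\<in>carrier ?L. (fst x \<union> fst a, snd x \<union> snd a) = (U, U) \<longrightarrow> a \<sqsubseteq>\<^bsub>?L\<^esub> ?y"
  proof (intro ballI impI)
    fix a assume "a \<in> carrier ?L" "(fst x \<union> fst a, snd x \<union> snd a) = (U, U)"
    then have "a \<in> F" by (simp add: rough_order_def F_def)
    then have "fst ?y \<subseteq> fst a \<and> snd ?y \<subseteq> snd a" unfolding fst_conv snd_conv by blast
    then show "a \<sqsubseteq>\<^bsub>?L\<^esub> ?y" by (simp add: rough_order_def)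
  qed
  moreover have "?y \<in> carrier ?L" using y by (simp add: rough_order_def)
  ultimately show "\<exists>y\<in>carrier ?L. (fst x \<union> fst y, snd x \<union> snd y) = (U, U) \<and>
      (\<forall>a\<in>carrier ?L. (fst x \<union> fst a, snd x \<union> snd a) = (U, U) \<longrightarrow> a \<sqsubseteq>\<^bsub>?L\<^esub> y)"
    by (intro bexI[of _ ?y] conjI)
qed

theorem proposition4p1:
  fixes U :: "'a set" and R :: "'a rel"
  assumes "U \<noteq> {}"
    and "preorder_on U R"
  shows "pseudocomplemented_lattice (rough_order U R) \<and>
         pseudocomplemented_lattice (inv_gorder (rough_order U R))"
  using assms(2) pseudocomplemented_rough_order pseudocomplemented_inv_rough_order by blast

end
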